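(* Let $D$ be an almost Dedekind domain that is not a field. Then $\mathrm{Crit}(D)\neq\mathrm{Max}(D)$, i.e. $D$ has at least one maximal ideal that is not critical. In particular, no almost Dedekind domain is an anti-SP domain.
   Context: An almost Dedekind domain is an integral domain $D$ such that the localization $D_M$ is a discrete valuation ring for every maximal ideal $M$ of $D$. A maximal ideal $M$ of an almost Dedekind domain $D$ is critical if $M$ does not contain any nonzero finitely generated radical ideal of $D$. $\mathrm{Crit}(D)$ denotes the set of critical maximal ideals of $D$ and $\mathrm{Max}(D)$ the set of all maximal ideals. An almost Dedekind domain $D$ is an anti-SP domain if $\mathrm{Max}(D)=\mathrm{Crit}(D)$. *)

theory Defs
  imports "HOL-Algebra.Ring_Divisibility"
begin

definition loc_rel :: "('a, 'm) ring_scheme \<Rightarrow> 'a set \<Rightarrow> (('a \<times> 'a) \<times> ('a \<times> 'a)) set"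
  where "loc_rel R S =
    {((a, s), (b, t)) | a s b t. a \<in> carrier R \<and> s \<in> S \<and> b \<in> carrier R \<and> t \<in> S \<and>
       (\<exists>u\<in>S. u \<otimes>\<^bsub>R\<^esub> ((a \<otimes>\<^bsub>R\<^esub> t) \<ominus>\<^bsub>R\<^esub> (b \<otimes>\<^bsub>R\<^esub> s)) = \<zero>\<^bsub>R\<^esub>)}"

definition loc_frac :: "('a, 'm) ring_scheme \<Rightarrow> 'a set \<Rightarrow> 'a \<Rightarrow> 'a \<Rightarrow> ('a \<times> 'a) set"
  where "loc_frac R S a s = loc_rel R S `` {(a, s)}"

text \<open>The localization \<open>S\<^sup>-\<^sup>1 R\<close> consists of the classes \<open>a/s = loc_frac R S a s\<close>, with
  \<open>a/s \<cdot> b/t = ab/st\<close> and \<open>a/s + b/t = (at + bs)/st\<close>. The operations are defined by taking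
  unions over all representatives; all classes united coincide
  (see \<open>loc_mult\<close> and \<open>loc_add\<close> below). It is meant for a commutative ring \<open>R\<close> and a
  multiplicatively closed \<open>S\<close>.\<close>

definition localization :: "('a, 'm) ring_scheme \<Rightarrow> 'a set \<Rightarrow> ('a \<times> 'a) set ring"
  where "localization R S =
    \<lparr> carrier = (carrier R \<times> S) // loc_rel R S,
      mult = (\<lambda>X Y. \<Union>(a, s)\<in>X. \<Union>(b, t)\<in>Y. loc_frac R S (a \<otimes>\<^bsub>R\<^esub> b) (s \<otimes>\<^bsub>R\<^esub> t)),
      one = loc_frac R S \<one>\<^bsub>R\<^esub> \<one>\<^bsub>R\<^esub>,
      zero = loc_frac R S \<zero>\<^bsub>R\<^esub> \<one>\<^bsub>R\<^esub>,
      add = (\<lambda>X Y. \<Union>(a, s)\<in>X. \<Union>(b, t)\<in>Y.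
               loc_frac R S ((a \<otimes>\<^bsub>R\<^esub> t) \<oplus>\<^bsub>R\<^esub> (b \<otimes>\<^bsub>R\<^esub> s)) (s \<otimes>\<^bsub>R\<^esub> t)) \<rparr>"

definition localization_at :: "('a, 'm) ring_scheme \<Rightarrow> 'a set \<Rightarrow> ('a \<times> 'a) set ring"
  where "localization_at R P = localization R (carrier R - P)"

text \<open>Following the usual convention, a field is not a discrete valuation ring.\<close>

definition discrete_valuation_ring :: "('a, 'm) ring_scheme \<Rightarrow> bool"
  where "discrete_valuation_ring R \<longleftrightarrow>
    principal_domain R \<and> (\<exists>!M. maximalideal M R) \<and> \<not> field R"

definition max_ideals :: "('a, 'm) ring_scheme \<Rightarrow> 'a set set"
  where "max_ideals R = {M. maximalideal M R}"

definition almost_dedekind_domain :: "('a, 'm) ring_scheme \<Rightarrow> bool"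
  where "almost_dedekind_domain D \<longleftrightarrow>
    domain D \<and> (\<forall>M\<in>max_ideals D. discrete_valuation_ring (localization_at D M))"

definition fin_gen_ideal :: "'a set \<Rightarrow> ('a, 'm) ring_scheme \<Rightarrow> bool"
  where "fin_gen_ideal I R \<longleftrightarrow> (\<exists>A\<subseteq>carrier R. finite A \<and> I = Idl\<^bsub>R\<^esub> A)"

definition radical :: "('a, 'm) ring_scheme \<Rightarrow> 'a set \<Rightarrow> 'a set"
  where "radical R I = {x \<in> carrier R. \<exists>n::nat. x [^]\<^bsub>R\<^esub> n \<in> I}"

definition radical_ideal :: "'a set \<Rightarrow> ('a, 'm) ring_scheme \<Rightarrow> bool"
  where "radical_ideal I R \<longleftrightarrow> ideal I R \<and> radical R I = I"

definition critical_ideals :: "('a, 'm) ring_scheme \<Rightarrow> 'a set set"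
  where "critical_ideals D =
    {M \<in> max_ideals D.
       \<not> (\<exists>I. fin_gen_ideal I D \<and> radical_ideal I D \<and> I \<noteq> {\<zero>\<^bsub>D\<^esub>} \<and> I \<subseteq> M)}"

definition anti_SP_domain :: "('a, 'm) ring_scheme \<Rightarrow> bool"
  where "anti_SP_domain D \<longleftrightarrow>
    almost_dedekind_domain D \<and> max_ideals D = critical_ideals D"

lemma UN_pairs_const:
  assumes "x \<in> X" "y \<in> Y"
    and "\<And>a s b t. (a, s) \<in> X \<Longrightarrow> (b, t) \<in> Y \<Longrightarrow> F a s b t = C"
  shows "(\<Union>(a, s)\<in>X. \<Union>(b, t)\<in>Y. F a s b t) = C"
proof -
  have "(\<Union>(b, t)\<in>Y. F a s b t) = C" if "(a, s) \<in> X" for a s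
    by (rule UN_constant_eq[OF assms(2)]) (use assms(3) that in auto)
  then show ?thesis
    by (intro UN_constant_eq[OF assms(1)]) (simp split: prod.split, blast)
qed

context cring
begin

context
  fixes S :: "'a set"
  assumes S_carr: "S \<subseteq> carrier R" and S_one: "\<one> \<in> S"
    and S_mult: "\<And>s t. s \<in> S \<Longrightarrow> t \<in> S \<Longrightarrow> s \<otimes> t \<in> S"
begin

lemma loc_rel_iff:
  "((a, s), (b, t)) \<in> loc_rel R S \<longleftrightarrow> a \<in> carrier R \<and> s \<in> S \<and> b \<in> carrier R \<and> t \<in> S \<and>
     (\<exists>u\<in>S. u \<otimes> (a \<otimes> t) = u \<otimes> (b \<otimes> s))"
proof -
  have "u \<otimes> ((a \<otimes> t) \<ominus> (b \<otimes> s)) = \<zero> \<longleftrightarrow> u \<otimes> (a \<otimes> t) = u \<otimes> (b \<otimes> s)"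
    if "a \<in> carrier R" "s \<in> S" "b \<in> carrier R" "t \<in> S" "u \<in> S" for u
  proof -
    have c: "s \<in> carrier R" "t \<in> carrier R" "u \<in> carrier R" using that S_carr by auto
    have "u \<otimes> ((a \<otimes> t) \<ominus> (b \<otimes> s)) = u \<otimes> (a \<otimes> t) \<ominus> u \<otimes> (b \<otimes> s)"
      using that c by (simp add: a_minus_def r_distr r_minus)
    then show ?thesis using that c by simp
  qed
  then show ?thesis unfolding loc_rel_def by auto
qed

lemma loc_rel_equiv: "equiv (carrier R \<times> S) (loc_rel R S)"
proof (rule equivI)
  show "loc_rel R S \<subseteq> (carrier R \<times> S) \<times> (carrier R \<times> S)"
    unfolding loc_rel_def by auto
  show "refl_on (carrier R \<times> S) (loc_rel R S)"
    by (rule refl_onI) (use S_one in \<open>auto simp: loc_rel_iff\<close>)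
  show "sym (loc_rel R S)"
  proof (rule symI)
    fix x y assume "(x, y) \<in> loc_rel R S"
    then show "(y, x) \<in> loc_rel R S"
      by (cases x; cases y) (simp add: loc_rel_iff, metis)
  qed
  show "trans (loc_rel R S)"
  proof (rule transI)
    fix x y z assume xy: "(x, y) \<in> loc_rel R S" and yz: "(y, z) \<in> loc_rel R S"
    obtain a s b t c r where xyz: "x = (a, s)" "y = (b, t)" "z = (c, r)" by (metis surj_pair)
    from xy obtain u where u: "a \<in> carrier R" "s \<in> S" "b \<in> carrier R" "t \<in> S" "u \<in> S"
      "u \<otimes> (a \<otimes> t) = u \<otimes> (b \<otimes> s)" by (auto simp: xyz loc_rel_iff)
    from yz obtain v where v: "c \<in> carrier R" "r \<in> S" "v \<in> S"
      "v \<otimes> (b \<otimes> r) = v \<otimes> (c \<otimes> t)" by (auto simp: xyz loc_rel_iff)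
    have cc: "s \<in> carrier R" "t \<in> carrier R" "r \<in> carrier R" "u \<in> carrier R" "v \<in> carrier R"
      using u v S_carr by auto
    have "(u \<otimes> v \<otimes> t) \<otimes> (a \<otimes> r) = (u \<otimes> (a \<otimes> t)) \<otimes> (v \<otimes> r)"
      using u(1,3) v(1) cc by (simp add: m_ac)
    also have "\<dots> = (v \<otimes> (b \<otimes> r)) \<otimes> (u \<otimes> s)"
      unfolding u(6) using u(1,3) v(1) cc by (simp add: m_ac)
    also have "\<dots> = (u \<otimes> v \<otimes> t) \<otimes> (c \<otimes> s)"
      unfolding v(4) using u(1,3) v(1) cc by (simp add: m_ac)
    finally show "(x, z) \<in> loc_rel R S"
      unfolding xyz loc_rel_iff using u v S_mult by blast
  qed
qed

lemma loc_frac_eq_iff: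
  assumes "a \<in> carrier R" "s \<in> S" "b \<in> carrier R" "t \<in> S"
  shows "loc_frac R S a s = loc_frac R S b t \<longleftrightarrow> ((a, s), (b, t)) \<in> loc_rel R S"
  unfolding loc_frac_def using assms by (intro eq_equiv_class_iff[OF loc_rel_equiv]) auto

lemma loc_mult:
  assumes "a \<in> carrier R" "s \<in> S" "b \<in> carrier R" "t \<in> S"
  shows "loc_frac R S a s \<otimes>\<^bsub>localization R S\<^esub> loc_frac R S b t = loc_frac R S (a \<otimes> b) (s \<otimes> t)"
proof -
  have *: "loc_frac R S (a' \<otimes> b') (s' \<otimes> t') = loc_frac R S (a \<otimes> b) (s \<otimes> t)"
    if as: "((a, s), (a', s')) \<in> loc_rel R S" and bt: "((b, t), (b', t')) \<in> loc_rel R S" for a' s' b' t'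
  proof -
    from as obtain u where u: "a' \<in> carrier R" "s' \<in> S" "u \<in> S"
      "u \<otimes> (a \<otimes> s') = u \<otimes> (a' \<otimes> s)" by (auto simp: loc_rel_iff)
    from bt obtain v where v: "b' \<in> carrier R" "t' \<in> S" "v \<in> S"
      "v \<otimes> (b \<otimes> t') = v \<otimes> (b' \<otimes> t)" by (auto simp: loc_rel_iff)
    have cc: "s \<in> carrier R" "t \<in> carrier R" "s' \<in> carrier R" "t' \<in> carrier R"
      "u \<in> carrier R" "v \<in> carrier R" using assms u v S_carr by auto
    have "(u \<otimes> v) \<otimes> ((a' \<otimes> b') \<otimes> (s \<otimes> t)) = (u \<otimes> (a' \<otimes> s)) \<otimes> (v \<otimes> (b' \<otimes> t))"
      using assms(1,3) u(1) v(1) cc by (simp add: m_ac)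
    also have "\<dots> = (u \<otimes> v) \<otimes> ((a \<otimes> b) \<otimes> (s' \<otimes> t'))"
      unfolding u(4)[symmetric] v(4)[symmetric]
      using assms(1,3) u(1) v(1) cc by (simp add: m_ac)
    finally have "((a' \<otimes> b', s' \<otimes> t'), (a \<otimes> b, s \<otimes> t)) \<in> loc_rel R S"
      unfolding loc_rel_iff using assms u v S_mult by blast
    then show ?thesis
      using assms u v S_mult by (subst loc_frac_eq_iff) auto
  qed
  have "((a, s), (a, s)) \<in> loc_rel R S" "((b, t), (b, t)) \<in> loc_rel R S"
    using assms S_one by (auto simp: loc_rel_iff)
  then have "(\<Union>(a', s')\<in>loc_frac R S a s. \<Union>(b', t')\<in>loc_frac R S b t.
      loc_frac R S (a' \<otimes> b') (s' \<otimes> t')) = loc_frac R S (a \<otimes> b) (s \<otimes> t)"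
    by (intro UN_pairs_const[of "(a, s)" _ "(b, t)"] *) (simp_all add: loc_frac_def)
  then show ?thesis by (simp add: localization_def)
qed

lemma loc_add:
  assumes "a \<in> carrier R" "s \<in> S" "b \<in> carrier R" "t \<in> S"
  shows "loc_frac R S a s \<oplus>\<^bsub>localization R S\<^esub> loc_frac R S b t =
    loc_frac R S ((a \<otimes> t) \<oplus> (b \<otimes> s)) (s \<otimes> t)"
proof -
  have *: "loc_frac R S ((a' \<otimes> t') \<oplus> (b' \<otimes> s')) (s' \<otimes> t') =
      loc_frac R S ((a \<otimes> t) \<oplus> (b \<otimes> s)) (s \<otimes> t)"
    if as: "((a, s), (a', s')) \<in> loc_rel R S" and bt: "((b, t), (b', t')) \<in> loc_rel R S" for a' s' b' t'
  proof -
    from as obtain u where u: "a' \<in> carrier R" "s' \<in> S" "u \<in> S"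
      "u \<otimes> (a \<otimes> s') = u \<otimes> (a' \<otimes> s)" by (auto simp: loc_rel_iff)
    from bt obtain v where v: "b' \<in> carrier R" "t' \<in> S" "v \<in> S"
      "v \<otimes> (b \<otimes> t') = v \<otimes> (b' \<otimes> t)" by (auto simp: loc_rel_iff)
    have cc: "s \<in> carrier R" "t \<in> carrier R" "s' \<in> carrier R" "t' \<in> carrier R"
      "u \<in> carrier R" "v \<in> carrier R" using assms u v S_carr by auto
    have "(u \<otimes> v) \<otimes> (((a' \<otimes> t') \<oplus> (b' \<otimes> s')) \<otimes> (s \<otimes> t)) =
        (u \<otimes> (a' \<otimes> s)) \<otimes> (v \<otimes> t' \<otimes> t) \<oplus> (v \<otimes> (b' \<otimes> t)) \<otimes> (u \<otimes> s' \<otimes> s)"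
      using assms(1,3) u(1) v(1) cc by (simp add: m_ac l_distr r_distr)
    also have "\<dots> = (u \<otimes> v) \<otimes> (((a \<otimes> t) \<oplus> (b \<otimes> s)) \<otimes> (s' \<otimes> t'))"
      unfolding u(4)[symmetric] v(4)[symmetric]
      using assms(1,3) u(1) v(1) cc by (simp add: m_ac l_distr r_distr)
    finally have "(((a' \<otimes> t') \<oplus> (b' \<otimes> s'), s' \<otimes> t'), ((a \<otimes> t) \<oplus> (b \<otimes> s), s \<otimes> t)) \<in> loc_rel R S"
      unfolding loc_rel_iff using assms u v cc S_mult by blast
    then show ?thesis
      using assms u v cc S_mult by (subst loc_frac_eq_iff) auto
  qed
  have "((a, s), (a, s)) \<in> loc_rel R S" "((b, t), (b, t)) \<in> loc_rel R S"
    using assms S_one by (auto simp: loc_rel_iff)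
  then have "(\<Union>(a', s')\<in>loc_frac R S a s. \<Union>(b', t')\<in>loc_frac R S b t.
      loc_frac R S ((a' \<otimes> t') \<oplus> (b' \<otimes> s')) (s' \<otimes> t')) =
      loc_frac R S ((a \<otimes> t) \<oplus> (b \<otimes> s)) (s \<otimes> t)"
    by (intro UN_pairs_const[of "(a, s)" _ "(b, t)"] *) (simp_all add: loc_frac_def)
  then show ?thesis by (simp add: localization_def)
qed

end

end

end

theory Submission
  imports Defs
begin

section \<open>Uniformizers and local powers, expressed inside the ring\<close>

text \<open>Denominators are cleared: \<open>s\<close> and \<open>u\<close> become units at
  \<open>M\<close>, so the equation says that \<open>y\<close> is a unit times the
  \<open>n\<close>-th power of \<open>p\<close> in the localization at \<open>M\<close>. Local
  orders can thus be handled without fractions.\<close>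

definition uniformizer :: "('a, 'm) ring_scheme \<Rightarrow> 'a set \<Rightarrow> 'a \<Rightarrow> bool"
  where "uniformizer R M p \<longleftrightarrow> p \<in> M \<and> p \<noteq> \<zero>\<^bsub>R\<^esub> \<and>
    (\<forall>y\<in>carrier R - {\<zero>\<^bsub>R\<^esub>}. \<exists>n::nat. \<exists>s\<in>carrier R - M. \<exists>u\<in>carrier R - M.
       s \<otimes>\<^bsub>R\<^esub> y = u \<otimes>\<^bsub>R\<^esub> p [^]\<^bsub>R\<^esub> n)"

text \<open>Up to units at \<open>M\<close>, \<open>y\<close> is an \<open>n\<close>-th power. As \<open>t\<close> need not be a uniformizer, \<open>n\<close> is any
  divisor of the valuation of \<open>y\<close>; this makes the condition open in \<open>M\<close>.\<close>

definition power_at :: "('a, 'm) ring_scheme \<Rightarrow> 'a set \<Rightarrow> 'a \<Rightarrow> nat \<Rightarrow> bool"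
  where "power_at R M y n \<longleftrightarrow> (\<exists>t\<in>M. \<exists>s\<in>carrier R - M. \<exists>u\<in>carrier R - M.
    s \<otimes>\<^bsub>R\<^esub> y = u \<otimes>\<^bsub>R\<^esub> t [^]\<^bsub>R\<^esub> n)"

section \<open>Ideals and maximal ideals of a commutative ring\<close>

lemma (in cring) ideal_if_closed:
  assumes "I \<subseteq> carrier R" "\<zero> \<in> I"
    and add: "\<And>a b. a \<in> I \<Longrightarrow> b \<in> I \<Longrightarrow> a \<oplus> b \<in> I"
    and mult: "\<And>a x. a \<in> I \<Longrightarrow> x \<in> carrier R \<Longrightarrow> x \<otimes> a \<in> I"
  shows "ideal I R"
proof (rule idealI[OF ring_axioms])
  have "\<ominus> a \<in> I" if "a \<in> I" for a
    using mult[OF that, of "\<ominus> \<one>"] that assms(1) l_minus[of \<one> a] by auto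
  then show "subgroup I (add_monoid R)"
    using assms by (intro group.subgroupI) (auto simp: a_inv_def[symmetric] intro: a_group)
  show "a \<otimes> x \<in> I" if "a \<in> I" "x \<in> carrier R" for a x
    using mult[OF that] that assms(1) by (metis m_comm subsetD)
qed (rule mult)

text \<open>Krull's theorem by Zorn's lemma: properness means missing the single element
  \<open>\<one>\<close>, so it survives unions of chains.\<close>

lemma (in cring) exists_maximalideal_containing:
  assumes I: "ideal I R" and "\<one> \<notin> I"
  shows "\<exists>M. maximalideal M R \<and> I \<subseteq> M"
proof -
  let ?A = "{J. ideal J R \<and> I \<subseteq> J \<and> \<one> \<notin> J}"
  have "\<exists>M\<in>?A. \<forall>X\<in>?A. M \<subseteq> X \<longrightarrow> X = M"
  proof (rule subset_Zorn_nonempty)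
    show "?A \<noteq> {}" using assms by blast
    fix C assume ne: "C \<noteq> {}" and C: "subset.chain ?A C"
    then have "subset.chain {I. ideal I R} C" unfolding subset.chain_def by blast
    from chain_Union_is_ideal[OF this] ne have "ideal (\<Union>C) R" by simp
    then show "\<Union>C \<in> ?A" using ne C unfolding subset.chain_def by blast
  qed
  then obtain M where "M \<in> ?A" and max: "\<forall>X\<in>?A. M \<subseteq> X \<longrightarrow> X = M" by (rule bexE)
  then have M: "ideal M R" "I \<subseteq> M" "\<one> \<notin> M" by simp_all
  have "maximalideal M R"
  proof (rule maximalidealI[OF M(1)])
    show "carrier R \<noteq> M" using M(3) by auto
    fix J assume J: "ideal J R" "M \<subseteq> J" "J \<subseteq> carrier R"
    show "J = M \<or> J = carrier R"
    proof (cases "\<one> \<in> J")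
      case True
      then show ?thesis using ideal.one_imp_carrier[OF J(1)] by simp
    next
      case False
      then have "J \<in> ?A" using J M(2) by auto
      then show ?thesis using max J(2) by simp
    qed
  qed
  then show ?thesis using M(2) by blast
qed

lemma maximalideal_one_notin:
  assumes "maximalideal M R" shows "\<one>\<^bsub>R\<^esub> \<notin> M"
  using assms ideal.one_imp_carrier maximalideal.I_notcarr maximalideal_def by metis

lemma (in cring) maximalideal_mult_notin:
  assumes M: "maximalideal M R" and "a \<in> carrier R - M" "b \<in> carrier R - M"
  shows "a \<otimes> b \<in> carrier R - M"
proof -
  interpret primeideal M R by (rule maximalideal_prime[OF M])
  show ?thesis using assms I_prime by auto
qed

lemma (in cring) maximalideal_pow_notin:
  fixes n :: nat
  assumes M: "maximalideal M R" and "a \<in> carrier R - M"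
  shows "a [^] n \<in> carrier R - M"
  using maximalideal_one_notin[OF M] maximalideal_mult_notin[OF M _ assms(2)]
  by (induction n) auto

lemma (in cring) maximalideal_cancel:
  assumes M: "maximalideal M R" and "a \<in> carrier R - M" "b \<in> carrier R" "a \<otimes> b \<in> M"
  shows "b \<in> M"
  using maximalideal_mult_notin[OF M assms(2)] assms by blast

lemma (in cring) maximalideal_mult_mem:
  assumes M: "maximalideal M R" and "b \<in> M" "a \<in> carrier R"
  shows "a \<otimes> b \<in> M"
  using assms ideal.I_l_closed maximalideal_def by metis

lemma maximalideal_subset:
  assumes M: "maximalideal M R" shows "M \<subseteq> carrier R"
  using assms unfolding maximalideal_def ideal_def
  by (meson additive_subgroup.a_subset)

section \<open>From discrete valuation rings to uniformizers in the domain\<close>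

text \<open>A generator \<open>p\<close> of the only maximal ideal divides every nonunit. Splitting
  off factors \<open>p\<close> from a nonzero \<open>y\<close> must stop, because proper
  divisibility in a principal ideal domain is well-founded.\<close>

lemma dvr_uniformizer:
  assumes L: "discrete_valuation_ring L"
  obtains p where "p \<in> carrier L" "p \<noteq> \<zero>\<^bsub>L\<^esub>" "p \<notin> Units L"
    "\<And>y. y \<in> carrier L \<Longrightarrow> y \<noteq> \<zero>\<^bsub>L\<^esub> \<Longrightarrow> \<exists>u\<in>Units L. \<exists>n::nat. y = u \<otimes>\<^bsub>L\<^esub> p [^]\<^bsub>L\<^esub> n"
proof -
  interpret principal_domain L using L by (simp add: discrete_valuation_ring_def)
  from L obtain M where M: "maximalideal M L" and uniq: "\<And>N. maximalideal N L \<Longrightarrow> N = M"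
    unfolding discrete_valuation_ring_def by blast
  from M have idM: "ideal M L" by (simp add: maximalideal_def)
  from exists_gen[OF idM] obtain p where p: "p \<in> carrier L" and Mp: "M = PIdl\<^bsub>L\<^esub> p" by blast
  have p0: "p \<noteq> \<zero>\<^bsub>L\<^esub>"
  proof
    assume "p = \<zero>\<^bsub>L\<^esub>"
    then have "M = {\<zero>\<^bsub>L\<^esub>}" using Mp by (simp add: cgenideal_eq_genideal genideal_zero)
    then show False
      using M L by (simp add: discrete_valuation_ring_def zeromaximalideal_eq_field)
  qed
  \<comment> \<open>A nonunit generates a proper ideal, and \<open>M\<close> is the only maximal
    ideal that can contain it.\<close>
  have nonunit: "a \<in> M" if a: "a \<in> carrier L" "a \<notin> Units L" for a
  proof -
    have "\<one>\<^bsub>L\<^esub> \<notin> PIdl\<^bsub>L\<^esub> a"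
    proof
      assume "\<one>\<^bsub>L\<^esub> \<in> PIdl\<^bsub>L\<^esub> a"
      then obtain x where "x \<in> carrier L" "\<one>\<^bsub>L\<^esub> = x \<otimes>\<^bsub>L\<^esub> a" unfolding cgenideal_def by blast
      then show False using a unfolding Units_def by (metis (mono_tags, lifting) m_comm mem_Collect_eq)
    qed
    then obtain N where "maximalideal N L" "PIdl\<^bsub>L\<^esub> a \<subseteq> N"
      using exists_maximalideal_containing[OF cgenideal_ideal[OF a(1)]] by blast
    then show ?thesis using uniq cgenideal_self[OF a(1)] by blast
  qed
  have pM: "p \<in> M" using cgenideal_self[OF p] Mp by simp
  have pU: "p \<notin> Units L"
    using maximalideal_one_notin[OF M] maximalideal_mult_mem[OF M pM] unfolding Units_def by force
  have fact: "\<exists>u\<in>Units L. \<exists>n::nat. y = u \<otimes>\<^bsub>L\<^esub> p [^]\<^bsub>L\<^esub> n" if "y \<in> carrier (mult_of L)" for y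
    using that
  proof (induction y rule: wf_induct_rule[OF mult_of.division_wellfounded])
    case (1 y)
    then have y: "y \<in> carrier L" "y \<noteq> \<zero>\<^bsub>L\<^esub>" by auto
    show ?case
    proof (cases "y \<in> Units L")
      case True
      then have "y = y \<otimes>\<^bsub>L\<^esub> p [^]\<^bsub>L\<^esub> (0::nat)" using y by simp
      then show ?thesis using True by blast
    next
      case False
      then obtain q where q: "q \<in> carrier L" "y = q \<otimes>\<^bsub>L\<^esub> p"
        using nonunit[OF y(1)] Mp unfolding cgenideal_def by blast
      then have q0: "q \<noteq> \<zero>\<^bsub>L\<^esub>" using y p by auto
      \<comment> \<open>If \<open>y\<close> divided \<open>q\<close>, cancelling \<open>q\<close>
        would make \<open>p\<close> a unit. Hence \<open>q\<close> is a proper factor of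
        \<open>y\<close> and the induction hypothesis applies to it.\<close>
      have "\<not> y divides\<^bsub>L\<^esub> q"
      proof
        assume "y divides\<^bsub>L\<^esub> q"
        then obtain c where c: "c \<in> carrier L" "q = y \<otimes>\<^bsub>L\<^esub> c" unfolding factor_def by blast
        then have "q \<otimes>\<^bsub>L\<^esub> \<one>\<^bsub>L\<^esub> = q \<otimes>\<^bsub>L\<^esub> (p \<otimes>\<^bsub>L\<^esub> c)" using q p by (simp add: m_assoc)
        then have "\<one>\<^bsub>L\<^esub> = p \<otimes>\<^bsub>L\<^esub> c" using q q0 p c by (metis m_lcancel m_closed one_closed)
        then show False using pU p c unfolding Units_def
          by (metis (mono_tags, lifting) m_comm mem_Collect_eq)
      qed
      then have "properfactor L q y"
        using q p unfolding properfactor_def factor_def by blast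
      then have "properfactor (mult_of L) q y"
        using properfactor_imp_properfactor_mult[of y q] y q by simp
      then obtain u and n :: nat where u: "u \<in> Units L" "q = u \<otimes>\<^bsub>L\<^esub> p [^]\<^bsub>L\<^esub> n"
        using 1 q q0 by (metis (no_types, lifting) Diff_iff carrier_mult_of case_prodI
          empty_iff insert_iff mem_Collect_eq)
      then have "y = u \<otimes>\<^bsub>L\<^esub> p [^]\<^bsub>L\<^esub> Suc n" using q p by (simp add: m_assoc Units_closed)
      then show ?thesis using u(1) by blast
    qed
  qed
  show thesis by (rule that[OF p p0 pU]) (use fact in auto)
qed

text \<open>A uniformizer of the localization is a fraction \<open>p/r\<close> whose denominator is
  a unit there, so the numerator \<open>p\<close> alone serves.\<close>

lemma (in domain) exists_uniformizer:
  assumes M: "maximalideal M R" and L: "discrete_valuation_ring (localization_at R M)"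
  shows "\<exists>p. uniformizer R M p"
proof -
  define S where "S = carrier R - M"
  define L where "L = localization R S"
  note S_one = maximalideal_one_notin[OF M]
  note S_mult = maximalideal_mult_notin[OF M]
  have S: "S \<subseteq> carrier R" "\<one> \<in> S" "\<And>s t. s \<in> S \<Longrightarrow> t \<in> S \<Longrightarrow> s \<otimes> t \<in> S"
    using S_one S_mult by (auto simp: S_def)
  have Sc: "s \<in> carrier R" if "s \<in> S" for s using that S(1) by blast
  have S0: "s \<noteq> \<zero>" if "s \<in> S" for s
    using that M additive_subgroup.zero_closed unfolding S_def maximalideal_def ideal_def by blast
  note mult = loc_mult[OF S, folded L_def]
  \<comment> \<open>In a domain the extra factor in \<open>loc_rel\<close> cancels, since
    \<open>\<zero>\<close> is not in \<open>S\<close>; equality of fractions is plain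
    cross-multiplication.\<close>
  have frac_eq: "loc_frac R S a s = loc_frac R S b t \<longleftrightarrow> a \<otimes> t = b \<otimes> s"
    if "a \<in> carrier R" "s \<in> S" "b \<in> carrier R" "t \<in> S" for a s b t
    using that S(2) S0 Sc
    by (simp add: loc_frac_eq_iff[OF S] loc_rel_iff[OF S]) (metis m_closed m_lcancel)
  have elem: "\<exists>a\<in>carrier R. \<exists>s\<in>S. X = loc_frac R S a s" if "X \<in> carrier L" for X
    using that unfolding L_def localization_def quotient_def loc_frac_def by auto
  have frac_closed: "loc_frac R S a s \<in> carrier L" if "a \<in> carrier R" "s \<in> S" for a s
    using that unfolding L_def localization_def quotient_def loc_frac_def by auto
  have one: "\<one>\<^bsub>L\<^esub> = loc_frac R S \<one> \<one>" and zero: "\<zero>\<^bsub>L\<^esub> = loc_frac R S \<zero> \<one>"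
    by (simp_all add: L_def localization_def)
  have dvr: "discrete_valuation_ring L" using L by (simp add: L_def localization_at_def S_def)
  then interpret L: principal_domain L by (simp add: discrete_valuation_ring_def)
  from dvr_uniformizer[OF dvr] obtain P where P: "P \<in> carrier L" "P \<noteq> \<zero>\<^bsub>L\<^esub>" "P \<notin> Units L"
    and fact: "\<And>y. y \<in> carrier L \<Longrightarrow> y \<noteq> \<zero>\<^bsub>L\<^esub> \<Longrightarrow>
      \<exists>u\<in>Units L. \<exists>n::nat. y = u \<otimes>\<^bsub>L\<^esub> P [^]\<^bsub>L\<^esub> n" by metis
  obtain p r where p: "p \<in> carrier R" "r \<in> S" "P = loc_frac R S p r" using elem[OF P(1)] by blast
  \<comment> \<open>Otherwise \<open>r/p\<close> would be an inverse of the nonunit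
    \<open>P\<close>.\<close>
  have pM: "p \<in> M"
  proof (rule ccontr)
    assume "p \<notin> M"
    then have pS: "p \<in> S" using p by (simp add: S_def)
    have "P \<otimes>\<^bsub>L\<^esub> loc_frac R S r p = \<one>\<^bsub>L\<^esub>"
      using p pS S Sc by (simp add: mult one frac_eq m_comm)
    then show False using P L.m_comm frac_closed[OF Sc[OF p(2)] pS]
      unfolding Units_def by (metis (mono_tags, lifting) mem_Collect_eq)
  qed
  have p0: "p \<noteq> \<zero>" using P(2) p S Sc by (auto simp: zero frac_eq)
  have pow: "P [^]\<^bsub>L\<^esub> n = loc_frac R S (p [^] n) (r [^] n) \<and> r [^] n \<in> S" for n :: nat
    using p S by (induction n) (auto simp: one mult)
  have "\<exists>n::nat. \<exists>s\<in>S. \<exists>u\<in>S. s \<otimes> y = u \<otimes> p [^] n" if y: "y \<in> carrier R" "y \<noteq> \<zero>" for y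
  proof -
    have "loc_frac R S y \<one> \<noteq> \<zero>\<^bsub>L\<^esub>" using y S by (simp add: zero frac_eq)
    from fact[OF frac_closed[OF y(1) S(2)] this] obtain U n
      where U: "U \<in> Units L" "loc_frac R S y \<one> = U \<otimes>\<^bsub>L\<^esub> P [^]\<^bsub>L\<^esub> (n::nat)" by blast
    obtain u a where u: "u \<in> carrier R" "a \<in> S" "U = loc_frac R S u a"
      using elem[OF L.Units_closed[OF U(1)]] by blast
    from U(1) obtain V where "V \<in> carrier L" "U \<otimes>\<^bsub>L\<^esub> V = \<one>\<^bsub>L\<^esub>" unfolding Units_def by blast
    then obtain v b where v: "v \<in> carrier R" "b \<in> S" "U \<otimes>\<^bsub>L\<^esub> loc_frac R S v b = \<one>\<^bsub>L\<^esub>"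
      using elem by blast
    \<comment> \<open>The units \<open>u/a\<close> and \<open>v/b\<close> are inverse to each other.
      Since \<open>a \<otimes> b\<close> is outside \<open>M\<close>, so is the numerator
      \<open>u\<close>.\<close>
    then have "u \<otimes> v = a \<otimes> b" using u S Sc by (simp add: mult one frac_eq)
    then have "v \<otimes> u \<in> S" using u v S by (simp add: m_comm)
    then have uS: "u \<in> S" using maximalideal_mult_mem[OF M _ v(1)] u unfolding S_def by blast
    have "y \<otimes> (a \<otimes> r [^] n) = u \<otimes> p [^] n"
      using U(2) u p y pow[of n] S Sc by (simp add: mult frac_eq)
    then have "(a \<otimes> r [^] n) \<otimes> y = u \<otimes> p [^] n" using u p y Sc by (simp add: m_comm)
    then show ?thesis using uS u pow[of n] S by blast
  qed
  then have "uniformizer R M p" using pM p0 unfolding uniformizer_def S_def by blast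
  then show ?thesis by blast
qed

section \<open>Divisibility and order at a maximal ideal\<close>

text \<open>The exponent of \<open>p\<close> in a nonzero \<open>t\<close> is positive, because
  exponent 0 would put the unit factor \<open>u\<close> into \<open>M\<close>. The case of
  \<open>\<zero>\<close> is separate since \<open>uniformizer\<close> factors only nonzero
  elements.\<close>

lemma (in domain) uniformizer_divides_locally:
  assumes M: "maximalideal M R" and p: "uniformizer R M p" and t: "t \<in> M"
  shows "\<exists>s\<in>carrier R - M. \<exists>c\<in>carrier R. s \<otimes> t = c \<otimes> p"
proof (cases "t = \<zero>")
  case True
  then show ?thesis
    using p maximalideal_one_notin[OF M] maximalideal_subset[OF M] unfolding uniformizer_def
    by (intro bexI[of _ \<one>] bexI[of _ \<zero>]) auto
next
  case False
  have tc: "t \<in> carrier R" and pc: "p \<in> carrier R"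
    using t p maximalideal_subset[OF M] by (auto simp: uniformizer_def)
  then obtain n :: nat and s u where su: "s \<in> carrier R - M" "u \<in> carrier R - M" "s \<otimes> t = u \<otimes> p [^] n"
    using p False unfolding uniformizer_def by blast
  have "n \<noteq> 0"
  proof
    assume "n = 0"
    then have "u = s \<otimes> t" using su by simp
    then show False using su maximalideal_mult_mem[OF M t] by auto
  qed
  then obtain k where "n = Suc k" by (cases n) auto
  then have "s \<otimes> t = (u \<otimes> p [^] k) \<otimes> p" using su pc by (simp add: m_assoc)
  then show ?thesis using su pc by blast
qed

text \<open>The order \<open>m\<close> of \<open>y\<close> at \<open>M\<close> is a bound: each
  \<open>t\<close> in \<open>M\<close> is locally a multiple of \<open>p\<close>, so its
  \<open>n\<close>-th power is locally divisible by the \<open>n\<close>-th power of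
  \<open>p\<close>.\<close>

lemma (in domain) power_at_bounded:
  assumes M: "maximalideal M R" and p: "uniformizer R M p"
    and y: "y \<in> carrier R" "y \<noteq> \<zero>"
  shows "\<exists>b. \<forall>n. power_at R M y n \<longrightarrow> n \<le> b"
proof -
  have pM: "p \<in> M" "p \<noteq> \<zero>" and pc: "p \<in> carrier R"
    using p maximalideal_subset[OF M] by (auto simp: uniformizer_def)
  obtain m :: nat and s u where su: "s \<in> carrier R - M" "u \<in> carrier R - M" "s \<otimes> y = u \<otimes> p [^] m"
    using p y unfolding uniformizer_def by blast
  have pow_p: "p [^] i \<noteq> \<zero>" for i :: nat
    using pM(2) pc by (induction i) (auto simp: integral_iff)
  have "n \<le> m" if "power_at R M y n" for n
  proof (rule ccontr)
    assume "\<not> n \<le> m"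
    then obtain k where n: "n = m + Suc k" by (metis less_natE not_le_imp_less add_Suc_right)
    from that obtain t a b where t: "t \<in> M" "a \<in> carrier R - M" "b \<in> carrier R - M"
      "a \<otimes> y = b \<otimes> t [^] n" unfolding power_at_def by blast
    obtain e c where e: "e \<in> carrier R - M" "c \<in> carrier R" "e \<otimes> t = c \<otimes> p"
      using uniformizer_divides_locally[OF M p t(1)] by blast
    have tc: "t \<in> carrier R" using t maximalideal_subset[OF M] by blast
    have cc: "s \<in> carrier R" "u \<in> carrier R" "a \<in> carrier R" "b \<in> carrier R" "e \<in> carrier R"
      using su t e by auto
    have "e [^] n \<otimes> t [^] n = c [^] n \<otimes> p [^] n"
      using e tc pc cc by (metis nat_pow_distrib)
    then have et: "e [^] n \<otimes> t [^] n = c [^] n \<otimes> p [^] Suc k \<otimes> p [^] m"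
      using e pc cc n by (simp add: nat_pow_mult[symmetric] m_ac del: nat_pow_Suc)
    \<comment> \<open>Both local expressions for \<open>y\<close> are compared after clearing
      multipliers. Cancelling \<open>p [^] m\<close> leaves an element outside \<open>M\<close>
      equal to a multiple of \<open>p\<close>.\<close>
    have "(e [^] n \<otimes> a \<otimes> u) \<otimes> p [^] m = (e [^] n \<otimes> a) \<otimes> (s \<otimes> y)"
      using su(3) cc pc by (simp add: m_assoc)
    also have "\<dots> = e [^] n \<otimes> s \<otimes> (a \<otimes> y)" using cc y by (simp add: m_ac)
    also have "\<dots> = (s \<otimes> b) \<otimes> (e [^] n \<otimes> t [^] n)"
      unfolding t(4) using cc tc by (simp add: m_ac)
    also have "\<dots> = ((s \<otimes> b) \<otimes> (c [^] n \<otimes> p [^] Suc k)) \<otimes> p [^] m"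
      unfolding et using cc pc e(2) by (simp add: m_assoc)
    finally have "e [^] n \<otimes> a \<otimes> u = (s \<otimes> b) \<otimes> (c [^] n \<otimes> p [^] Suc k)"
      using pow_p pc cc e(2) m_rcancel by (metis m_closed nat_pow_closed)
    also have "\<dots> = (s \<otimes> b \<otimes> c [^] n \<otimes> p [^] k) \<otimes> p"
      using pc cc e(2) by (simp add: m_assoc)
    also have "\<dots> \<in> M" using maximalideal_mult_mem[OF M pM(1)] pc cc e(2) by simp
    finally show False
      using maximalideal_mult_notin[OF M maximalideal_mult_notin[OF M
        maximalideal_pow_notin[OF M e(1)] t(2)] su(2)] by blast
  qed
  then show ?thesis by blast
qed

section \<open>Zero-dimensionality modulo a nonzero element\<close>

text \<open>The ring modulo \<open>y\<close> is zero-dimensional, hence \<open>\<pi>\<close>-regular.\<close>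

lemma (in domain) pi_regular_mod:
  assumes unif: "\<And>M. maximalideal M R \<Longrightarrow> \<exists>p. uniformizer R M p"
    and y: "y \<in> carrier R" "y \<noteq> \<zero>" and w: "w \<in> carrier R"
  shows "\<exists>m::nat. \<exists>z\<in>carrier R. \<exists>d\<in>carrier R. (\<one> \<ominus> z \<otimes> w) \<otimes> w [^] m = d \<otimes> y"
proof -
  \<comment> \<open>These are the \<open>c\<close> that multiply some \<open>w [^] m\<close> into
    the ideal generated by \<open>y\<close> and \<open>w [^] Suc m\<close>. Membership of
    \<open>\<one>\<close> is the claim rearranged, so it suffices that no maximal ideal contains
    \<open>C\<close>.\<close>
  define C where "C = {c \<in> carrier R. \<exists>m::nat. \<exists>z\<in>carrier R. \<exists>d\<in>carrier R.
    c \<otimes> w [^] m = d \<otimes> y \<oplus> z \<otimes> w [^] Suc m}"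
  have CI: "c \<in> C" if "c \<in> carrier R" "z \<in> carrier R" "d \<in> carrier R"
    "c \<otimes> w [^] m = d \<otimes> y \<oplus> z \<otimes> w [^] Suc m" for c z d and m :: nat
    using that unfolding C_def by blast
  have "ideal C R"
  proof (rule ideal_if_closed)
    show "C \<subseteq> carrier R" unfolding C_def by blast
    show "\<zero> \<in> C" using w y by (intro CI[of _ \<zero> \<zero> 0]) auto
  next
    fix a b assume "a \<in> C" "b \<in> C"
    then obtain m z d n z' d' where a: "a \<in> carrier R" "z \<in> carrier R" "d \<in> carrier R"
      "a \<otimes> w [^] (m::nat) = d \<otimes> y \<oplus> z \<otimes> w [^] Suc m"
      and b: "b \<in> carrier R" "z' \<in> carrier R" "d' \<in> carrier R"
      "b \<otimes> w [^] (n::nat) = d' \<otimes> y \<oplus> z' \<otimes> w [^] Suc n"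
      unfolding C_def by blast
    have "(a \<oplus> b) \<otimes> w [^] (m + n) = (a \<otimes> w [^] m) \<otimes> w [^] n \<oplus> (b \<otimes> w [^] n) \<otimes> w [^] m"
      using a(1) b(1) w by (simp add: nat_pow_mult[symmetric] l_distr r_distr m_ac)
    also have "\<dots> = (d \<otimes> w [^] n \<oplus> d' \<otimes> w [^] m) \<otimes> y \<oplus> (z \<oplus> z') \<otimes> w [^] Suc (m + n)"
      unfolding a(4) b(4) using a(1-3) b(1-3) w y
      by (simp add: nat_pow_mult[symmetric] l_distr r_distr m_ac a_ac)
    finally show "a \<oplus> b \<in> C" using a(1-3) b(1-3) w by (intro CI) auto
  next
    fix a x assume "a \<in> C" and x: "x \<in> carrier R"
    then obtain m z d where a: "a \<in> carrier R" "z \<in> carrier R" "d \<in> carrier R"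
      "a \<otimes> w [^] (m::nat) = d \<otimes> y \<oplus> z \<otimes> w [^] Suc m"
      unfolding C_def by blast
    have "(x \<otimes> a) \<otimes> w [^] m = x \<otimes> (a \<otimes> w [^] m)" using a(1) x w by (simp add: m_assoc)
    also have "\<dots> = (x \<otimes> d) \<otimes> y \<oplus> (x \<otimes> z) \<otimes> w [^] Suc m"
      unfolding a(4) using a(1-3) x w y by (simp add: r_distr m_assoc)
    finally show "x \<otimes> a \<in> C" using a(1-3) x by (intro CI) auto
  qed
  have "\<one> \<in> C"
  proof (rule ccontr)
    assume "\<one> \<notin> C"
    then obtain N where N: "maximalideal N R" "C \<subseteq> N"
      using exists_maximalideal_containing[OF \<open>ideal C R\<close>] by blast
    obtain p where p: "uniformizer R N p" using unif[OF N(1)] by blast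
    have pc: "p \<in> carrier R" using p maximalideal_subset[OF N(1)] by (auto simp: uniformizer_def)
    \<comment> \<open>The exponent 0 with \<open>z = \<one>\<close> puts \<open>w\<close> itself
      into \<open>C\<close>, hence into \<open>N\<close>.\<close>
    have "w \<in> C" using w y by (intro CI[of _ \<one> \<zero> 0]) auto
    then have "w \<in> N" using N by blast
    then obtain e c where e: "e \<in> carrier R - N" "c \<in> carrier R" "e \<otimes> w = c \<otimes> p"
      using uniformizer_divides_locally[OF N(1) p] by blast
    obtain n :: nat and s u where su: "s \<in> carrier R - N" "u \<in> carrier R - N" "s \<otimes> y = u \<otimes> p [^] n"
      using p y unfolding uniformizer_def by blast
    have cc: "s \<in> carrier R" "u \<in> carrier R" "e \<in> carrier R" using su e by auto
    have ew: "e [^] n \<otimes> w [^] n = c [^] n \<otimes> p [^] n"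
      using e w pc cc by (metis nat_pow_distrib)
    \<comment> \<open>Here \<open>n\<close> is the order of \<open>y\<close> at \<open>N\<close> and
      \<open>w\<close> is locally a multiple of \<open>p\<close>, so \<open>w [^] n\<close> is
      locally a multiple of \<open>y\<close>. The multiplier \<open>u \<otimes> e [^] n\<close> that
      shows this is in \<open>C\<close> but outside \<open>N\<close>.\<close>
    have "(u \<otimes> e [^] n) \<otimes> w [^] n = u \<otimes> (e [^] n \<otimes> w [^] n)" using cc w by (simp add: m_assoc)
    also have "\<dots> = c [^] n \<otimes> (u \<otimes> p [^] n)" unfolding ew using cc pc e(2) by (simp add: m_ac)
    also have "\<dots> = (c [^] n \<otimes> s) \<otimes> y" unfolding su(3)[symmetric] using cc e(2) y by (simp add: m_assoc)
    finally have "u \<otimes> e [^] n \<in> C"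
      using cc w e(2) y by (intro CI[of _ \<zero> "c [^] n \<otimes> s" n]) auto
    then show False
      using N maximalideal_mult_notin[OF N(1)] maximalideal_pow_notin[OF N(1)] e(1) su(2) by blast
  qed
  then obtain m z d where z: "z \<in> carrier R" "d \<in> carrier R"
    "\<one> \<otimes> w [^] (m::nat) = d \<otimes> y \<oplus> z \<otimes> w [^] Suc m"
    unfolding C_def by blast
  have "(\<one> \<ominus> z \<otimes> w) \<otimes> w [^] m = \<one> \<otimes> w [^] m \<ominus> z \<otimes> w [^] Suc m"
    using z(1,2) w y by (simp add: minus_eq l_distr r_distr l_minus r_minus m_ac)
  also have "\<dots> = d \<otimes> y"
    unfolding z(3) using z(1,2) w y by (simp add: minus_eq a_assoc r_neg)
  finally show ?thesis using z by blast
qed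

section \<open>Bounding the local order on a clopen region\<close>

text \<open>Baire category argument on the compact space of maximal ideals containing \<open>y\<close>, with the
  clopen sets given by \<open>w \<notin> M\<close>. If \<open>y\<close> had unbounded local order on all of them, a descending
  sequence of these sets with growing order would have a common point, because the
  saturations \<open>(y) : w\<^sup>\<infinity>\<close> defining them form an increasing chain of proper ideals.\<close>

lemma (in domain) exists_bounded_region:
  assumes unif: "\<And>M. maximalideal M R \<Longrightarrow> \<exists>p. uniformizer R M p"
    and y: "y \<in> carrier R" "y \<noteq> \<zero>" and M0: "maximalideal M0 R" "y \<in> M0"
  shows "\<exists>w\<in>carrier R. (\<exists>M. maximalideal M R \<and> y \<in> M \<and> w \<notin> M) \<and>
    (\<exists>b. \<forall>M n. maximalideal M R \<and> y \<in> M \<and> w \<notin> M \<and> power_at R M y n \<longrightarrow> n \<le> b)"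
proof (rule ccontr)
  define U where "U w = {M. maximalideal M R \<and> y \<in> M \<and> w \<notin> M}" for w
  assume "\<not> ?thesis"
  then have unbounded: "\<exists>M\<in>U w. \<exists>n>b. power_at R M y n" if "w \<in> carrier R" "U w \<noteq> {}" for w b
    using that unfolding U_def by (auto simp: not_le) blast
  have step: "\<exists>w'. (w' \<in> carrier R \<and> U w' \<noteq> {}) \<and> (\<exists>c\<in>carrier R. w' = w \<otimes> c) \<and>
      (\<forall>N\<in>U w'. \<exists>n>k. power_at R N y n)" if w: "w \<in> carrier R \<and> U w \<noteq> {}" for w and k :: nat
  proof -
    obtain M n where M: "maximalideal M R" "y \<in> M" "w \<notin> M" and n: "n > k" "power_at R M y n"
      using unbounded[of w k] w unfolding U_def by blast
    from n(2) obtain t s u where t: "t \<in> M" "s \<in> carrier R - M" "u \<in> carrier R - M"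
      "s \<otimes> y = u \<otimes> t [^] n" unfolding power_at_def by blast
    have tc: "t \<in> carrier R" using t maximalideal_subset[OF M(1)] by blast
    \<comment> \<open>Inverting \<open>s\<close> and \<open>u\<close> as well makes the same
      equation valid with unit coefficients on the whole smaller region; there \<open>t\<close> lies
      in \<open>N\<close> because its \<open>n\<close>-th power does.\<close>
    let ?w = "w \<otimes> (s \<otimes> u)"
    have "M \<in> U ?w"
      using M w t maximalideal_mult_notin[OF M(1)] unfolding U_def by auto
    moreover have "power_at R N y n" if "N \<in> U ?w" for N
    proof -
      have N: "maximalideal N R" "y \<in> N" "?w \<notin> N" using that by (auto simp: U_def)
      have "s \<notin> N" "u \<notin> N"
        using N(3) maximalideal_mult_mem[OF N(1)] w t
        by (metis DiffD1 m_closed m_comm)+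
      then have su: "s \<in> carrier R - N" "u \<in> carrier R - N" using t by auto
      have "u \<otimes> t [^] n \<in> N" using maximalideal_mult_mem[OF N(1,2)] t by force
      then have "t [^] n \<in> N" using maximalideal_cancel[OF N(1) su(2)] tc by simp
      then have "t \<in> N" using maximalideal_pow_notin[OF N(1)] tc by blast
      then show ?thesis using su t(4) unfolding power_at_def by blast
    qed
    ultimately show ?thesis using n(1) w t
      by (intro exI[of _ ?w] conjI bexI[of _ "s \<otimes> u"]) auto
  qed
  have "\<exists>x. x \<in> carrier R \<and> U x \<noteq> {}"
    using M0 maximalideal_one_notin[OF M0(1)] unfolding U_def by blast
  from dependent_nat_choice[of "\<lambda>k w. w \<in> carrier R \<and> U w \<noteq> {}"
      "\<lambda>k w w'. (\<exists>c\<in>carrier R. w' = w \<otimes> c) \<and> (\<forall>N\<in>U w'. \<exists>n>k. power_at R N y n)", OF this step]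
  obtain f where f: "\<And>k. f k \<in> carrier R" "\<And>k. U (f k) \<noteq> {}"
    "\<And>k. \<exists>c\<in>carrier R. f (Suc k) = f k \<otimes> c"
    "\<And>k. \<forall>N\<in>U (f (Suc k)). \<exists>n>k. power_at R N y n" by blast
  define J where "J w = {c \<in> carrier R. \<exists>m::nat. \<exists>d\<in>carrier R. c \<otimes> w [^] m = d \<otimes> y}" for w
  have J_ideal: "ideal (J w) R" if w: "w \<in> carrier R" for w
  proof (rule ideal_if_closed)
    show "J w \<subseteq> carrier R" unfolding J_def by blast
    have "\<zero> \<otimes> w [^] (0::nat) = \<zero> \<otimes> y" using y by simp
    then show "\<zero> \<in> J w" unfolding J_def by blast
  next
    fix a b assume "a \<in> J w" "b \<in> J w"
    then obtain m d n d' where a: "a \<in> carrier R" "d \<in> carrier R" "a \<otimes> w [^] (m::nat) = d \<otimes> y"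
      and b: "b \<in> carrier R" "d' \<in> carrier R" "b \<otimes> w [^] (n::nat) = d' \<otimes> y"
      unfolding J_def by blast
    have "(a \<oplus> b) \<otimes> w [^] (m + n) = (a \<otimes> w [^] m) \<otimes> w [^] n \<oplus> (b \<otimes> w [^] n) \<otimes> w [^] m"
      using a(1) b(1) w by (simp add: nat_pow_mult[symmetric] l_distr r_distr m_ac)
    also have "\<dots> = (d \<otimes> w [^] n \<oplus> d' \<otimes> w [^] m) \<otimes> y"
      unfolding a(3) b(3) using a(1,2) b(1,2) w y by (simp add: l_distr r_distr m_ac)
    finally show "a \<oplus> b \<in> J w"
      unfolding J_def using a(1,2) b(1,2) w
      by (auto intro!: exI[of _ "m + n"] bexI[of _ "d \<otimes> w [^] n \<oplus> d' \<otimes> w [^] m"])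
  next
    fix a x assume "a \<in> J w" and x: "x \<in> carrier R"
    then obtain m d where a: "a \<in> carrier R" "d \<in> carrier R" "a \<otimes> w [^] (m::nat) = d \<otimes> y"
      unfolding J_def by blast
    have "(x \<otimes> a) \<otimes> w [^] m = (x \<otimes> d) \<otimes> y" using a x w y by (simp add: m_assoc)
    then show "x \<otimes> a \<in> J w" unfolding J_def using a x by blast
  qed
  have "J (f k) \<subseteq> J (f (Suc k))" for k
  proof
    fix a assume "a \<in> J (f k)"
    then obtain m d where a: "a \<in> carrier R" "d \<in> carrier R" "a \<otimes> f k [^] (m::nat) = d \<otimes> y"
      unfolding J_def by blast
    obtain c where c: "c \<in> carrier R" "f (Suc k) = f k \<otimes> c" using f(3) by blast
    have "a \<otimes> f (Suc k) [^] m = (a \<otimes> f k [^] m) \<otimes> c [^] m"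
      using a(1) c f(1) by (simp add: nat_pow_distrib m_assoc)
    also have "\<dots> = (d \<otimes> c [^] m) \<otimes> y" unfolding a(3) using a(2) c(1) y by (simp add: m_ac)
    finally show "a \<in> J (f (Suc k))" unfolding J_def using a c by blast
  qed
  then have mono: "J (f i) \<subseteq> J (f j)" if "i \<le> j" for i j
    using lift_Suc_mono_le[of "\<lambda>k. J (f k)"] that by blast
  have "J (f i) \<subseteq> J (f j) \<or> J (f j) \<subseteq> J (f i)" for i j
    using mono nat_le_linear by metis
  then have "subset.chain {I. ideal I R} (range (\<lambda>k. J (f k)))"
    unfolding subset_chain_def using J_ideal f(1) by (simp add: image_subset_iff)
  from chain_Union_is_ideal[OF this] have "ideal (\<Union>k. J (f k)) R" by simp
  \<comment> \<open>If \<open>\<one>\<close> were in \<open>J (f k)\<close>, a power of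
    \<open>f k\<close> would lie in every maximal ideal containing \<open>y\<close>, and
    \<open>U (f k)\<close> would be empty.\<close>
  moreover have "\<one> \<notin> (\<Union>k. J (f k))"
  proof
    assume "\<one> \<in> (\<Union>k. J (f k))"
    then obtain k m d where d: "d \<in> carrier R" "f k [^] (m::nat) = d \<otimes> y"
      unfolding J_def using f(1) by auto
    obtain N where N: "maximalideal N R" "y \<in> N" "f k \<notin> N" using f(2)[of k] unfolding U_def by blast
    then show False
      using maximalideal_pow_notin[OF N(1), of "f k" m] f(1) d maximalideal_mult_mem[OF N(1,2)] by auto
  qed
  ultimately obtain N where N: "maximalideal N R" and "(\<Union>k. J (f k)) \<subseteq> N"
    using exists_maximalideal_containing by metis
  then have JN: "J (f k) \<subseteq> N" for k by (simp add: UN_subset_iff)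
  interpret N: maximalideal N R by (rule N)
  \<comment> \<open>Containing \<open>J (f k)\<close> is enough to belong to the region:
    \<open>pi_regular_mod\<close> puts some \<open>\<one> \<ominus> z \<otimes> f k\<close> into
    \<open>J (f k)\<close>, so \<open>f k\<close> cannot lie in \<open>N\<close> as well.\<close>
  have "N \<in> U (f k)" for k
  proof -
    have "y \<otimes> f k [^] (0::nat) = \<one> \<otimes> y" using y by simp
    then have "y \<in> J (f k)" unfolding J_def using y by blast
    obtain m z d where z: "z \<in> carrier R" "d \<in> carrier R"
      "(\<one> \<ominus> z \<otimes> f k) \<otimes> f k [^] (m::nat) = d \<otimes> y"
      using pi_regular_mod[OF unif y f(1)] by blast
    then have "\<one> \<ominus> z \<otimes> f k \<in> J (f k)" unfolding J_def using f(1) by auto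
    then have zN: "\<one> \<ominus> z \<otimes> f k \<in> N" using JN by blast
    have "f k \<notin> N"
    proof
      assume "f k \<in> N"
      then have "(\<one> \<ominus> z \<otimes> f k) \<oplus> z \<otimes> f k \<in> N" using zN z(1) N.I_l_closed N.a_closed by blast
      then have "\<one> \<in> N" using z(1) f(1) by (simp add: minus_eq a_assoc l_neg)
      then show False using maximalideal_one_notin[OF N] by blast
    qed
    then show ?thesis using N JN \<open>y \<in> J (f k)\<close> unfolding U_def by blast
  qed
  \<comment> \<open>The common point \<open>N\<close> lies in each \<open>U (f (Suc k))\<close>, so
    \<open>y\<close> has unbounded exponents there, against \<open>power_at_bounded\<close>.\<close>
  then have "\<exists>n>k. power_at R N y n" for k using f(4) by blast
  then show False using power_at_bounded[OF N _ y] unif[OF N] by (metis not_le)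
qed

section \<open>A finitely generated radical ideal and a noncritical maximal ideal\<close>

text \<open>At a maximal ideal where the local order of \<open>y\<close> is maximal on such a region, \<open>y\<close> is
  locally a power of \<open>t\<close>; maximality forces \<open>t\<close> to have order one throughout a smaller
  region, and cutting \<open>t\<close> down to that region gives a radical ideal.\<close>

lemma (in domain) exists_noncritical:
  assumes unif: "\<And>M. maximalideal M R \<Longrightarrow> \<exists>p. uniformizer R M p"
  shows "\<exists>M\<in>max_ideals R. M \<notin> critical_ideals R"
proof -
  have "\<one> \<notin> {\<zero>}" by simp
  then obtain M0 where M0: "maximalideal M0 R"
    using exists_maximalideal_containing[OF zeroideal] by blast
  then obtain y where y: "y \<in> M0" "y \<noteq> \<zero>" using unif unfolding uniformizer_def by blast
  then have yc: "y \<in> carrier R" using maximalideal_subset[OF M0] by blast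
  from exists_bounded_region[OF unif yc y(2) M0 y(1)] obtain w b M1
    where w: "w \<in> carrier R" and M1: "maximalideal M1 R" "y \<in> M1" "w \<notin> M1"
      and b: "\<And>M n. maximalideal M R \<Longrightarrow> y \<in> M \<Longrightarrow> w \<notin> M \<Longrightarrow> power_at R M y n \<Longrightarrow> n \<le> b"
    by blast
  \<comment> \<open>The exponents occurring on the region: bounded by \<open>b\<close>, and nonempty
    because the order of \<open>y\<close> at \<open>M1\<close> occurs. So a largest one
    exists.\<close>
  define A where "A = {n. \<exists>M. maximalideal M R \<and> y \<in> M \<and> w \<notin> M \<and> power_at R M y n}"
  have "A \<subseteq> {..b}" unfolding A_def using b by auto
  then have fin: "finite A" by (rule finite_subset) simp
  obtain p1 where p1: "uniformizer R M1 p1" using unif[OF M1(1)] by blast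
  have "\<exists>n. power_at R M1 y n"
    using p1 yc y(2) unfolding uniformizer_def power_at_def by blast
  then have "A \<noteq> {}" unfolding A_def using M1 by blast
  define n where "n = Max A"
  have "n \<in> A" using fin \<open>A \<noteq> {}\<close> by (simp add: n_def)
  have n_max: "k \<le> n" if "k \<in> A" for k using that fin by (simp add: n_def)
  obtain M where M: "maximalideal M R" "y \<in> M" "w \<notin> M" and "power_at R M y n"
    using \<open>n \<in> A\<close> unfolding A_def by blast
  then obtain t s u where t: "t \<in> M" "s \<in> carrier R - M" "u \<in> carrier R - M"
    "s \<otimes> y = u \<otimes> t [^] n" unfolding power_at_def by blast
  have tc: "t \<in> carrier R" using t maximalideal_subset[OF M(1)] by blast
  have "n \<noteq> 0"
  proof
    assume "n = 0"
    then have "u = s \<otimes> y" using t by simp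
    then show False using t maximalideal_mult_mem[OF M(1,2)] by auto
  qed
  define v where "v = w \<otimes> (s \<otimes> u)"
  have vM: "v \<in> carrier R - M"
    using M w t maximalideal_mult_notin[OF M(1)] unfolding v_def by auto
  obtain m z d where z: "z \<in> carrier R" "d \<in> carrier R" "(\<one> \<ominus> z \<otimes> v) \<otimes> v [^] (m::nat) = d \<otimes> y"
    using pi_regular_mod[OF unif yc y(2)] vM by blast
  \<comment> \<open>A power of \<open>v\<close> kills \<open>e\<close> modulo \<open>y\<close>, so a
    maximal ideal containing \<open>y\<close> contains \<open>e\<close> exactly when it omits
    \<open>v\<close>. Thus \<open>e\<close> cuts out the region where \<open>w\<close>,
    \<open>s\<close> and \<open>u\<close> are all units.\<close>
  define e where "e = \<one> \<ominus> z \<otimes> v"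
  have ec: "e \<in> carrier R" using z vM by (simp add: e_def)
  \<comment> \<open>The generator \<open>y\<close> makes the ideal nonzero, \<open>e\<close>
    confines the maximal ideals above it to the region, and \<open>t\<close> will be a local
    uniformizer at each of them.\<close>
  define I where "I = Idl {y, t, e}"
  have gens: "{y, t, e} \<subseteq> carrier R" using yc tc ec by simp
  have I: "ideal I R" unfolding I_def by (rule genideal_ideal[OF gens])
  interpret I: ideal I R by (rule I)
  have gI: "y \<in> I" "t \<in> I" "e \<in> I" using genideal_self[OF gens] by (auto simp: I_def)
  have "v [^] m \<otimes> e \<in> M"
    using z vM maximalideal_mult_mem[OF M(1,2) z(2)] by (simp add: e_def m_comm)
  then have "e \<in> M" using maximalideal_cancel[OF M(1) maximalideal_pow_notin[OF M(1) vM] ec] by blast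
  then have IM: "I \<subseteq> M"
    unfolding I_def using M t by (intro genideal_minimal) (auto simp: maximalideal_def)
  \<comment> \<open>Radicality is tested locally: for \<open>x\<close> outside \<open>I\<close> the
    colon ideal \<open>Q\<close> lies in some maximal \<open>N\<close>, and the contradiction is a
    multiplier of \<open>x\<close> into \<open>I\<close> that is outside \<open>N\<close>.\<close>
  have rad: "x \<in> I" if x: "x \<in> carrier R" "x [^] (j::nat) \<in> I" for x j
  proof (rule ccontr)
    assume "x \<notin> I"
    define Q where "Q = {c \<in> carrier R. c \<otimes> x \<in> I}"
    have "ideal Q R"
      unfolding Q_def using x
      by (intro ideal_if_closed) (auto simp: l_distr m_assoc intro: I.I_l_closed)
    moreover have "\<one> \<notin> Q" using \<open>x \<notin> I\<close> x by (simp add: Q_def)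
    ultimately obtain N where N: "maximalideal N R" "Q \<subseteq> N"
      using exists_maximalideal_containing by blast
    interpret N: maximalideal N R by (rule N(1))
    have "I \<subseteq> Q" unfolding Q_def using x I.I_r_closed I.a_subset by blast
    then have gN: "y \<in> N" "t \<in> N" "e \<in> N" "x [^] j \<in> N" using gI x N by auto
    have xN: "x \<in> N" using gN(4) maximalideal_pow_notin[OF N(1)] x by blast
    have "v \<notin> N"
    proof
      assume "v \<in> N"
      then have "e \<oplus> z \<otimes> v \<in> N" using gN(3) z(1) N.I_l_closed N.a_closed by blast
      then have "\<one> \<in> N" using z(1) vM by (simp add: e_def minus_eq a_assoc l_neg)
      then show False using maximalideal_one_notin[OF N(1)] by blast
    qed
    then have "w \<notin> N" "s \<notin> N" "u \<notin> N"
      using N.I_l_closed N.I_r_closed w t unfolding v_def by auto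
    then have su: "s \<in> carrier R - N" "u \<in> carrier R - N" using t by auto
    obtain p where p: "uniformizer R N p" using unif[OF N(1)] by blast
    have pN: "p \<in> N" and pc: "p \<in> carrier R"
      using p maximalideal_subset[OF N(1)] by (auto simp: uniformizer_def)
    have "t \<noteq> \<zero>"
    proof
      assume "t = \<zero>"
      then have "s \<otimes> y = \<zero>" using t \<open>n \<noteq> 0\<close> by (simp add: nat_pow_zero)
      moreover have "\<zero> \<in> M" using I.zero_closed IM by blast
      ultimately show False using t(2) yc y(2) integral[of s y] by auto
    qed
    \<comment> \<open>Up to units at \<open>N\<close>, \<open>y\<close> is \<open>t [^] n\<close>
      and \<open>t\<close> is \<open>p [^] k\<close>, so \<open>k * n\<close> belongs to
      \<open>A\<close>. As \<open>n\<close> is its maximum and positive, \<open>k\<close> is at most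
      1.\<close>
    then obtain k :: nat and a c where a: "a \<in> carrier R - N" "c \<in> carrier R - N" "a \<otimes> t = c \<otimes> p [^] k"
      using p tc unfolding uniformizer_def by blast
    have ac: "a \<in> carrier R" "c \<in> carrier R" "s \<in> carrier R" "u \<in> carrier R" using a t by auto
    have at: "a [^] n \<otimes> t [^] n = c [^] n \<otimes> p [^] (k * n)"
      using a(3) ac tc pc by (metis nat_pow_distrib nat_pow_pow nat_pow_closed)
    have "(a [^] n \<otimes> s) \<otimes> y = a [^] n \<otimes> (u \<otimes> t [^] n)"
      using ac yc t(4) by (simp add: m_assoc)
    also have "\<dots> = u \<otimes> (a [^] n \<otimes> t [^] n)" using ac tc by (simp add: m_ac)
    also have "\<dots> = (u \<otimes> c [^] n) \<otimes> p [^] (k * n)" unfolding at using ac pc by (simp add: m_assoc)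
    finally have "power_at R N y (k * n)"
      unfolding power_at_def using pN su a maximalideal_mult_notin[OF N(1)] maximalideal_pow_notin[OF N(1)]
      by blast
    then have "k * n \<in> A" unfolding A_def using N(1) gN \<open>w \<notin> N\<close> by blast
    then have "k \<le> 1" using n_max \<open>n \<noteq> 0\<close> by fastforce
    moreover have "k \<noteq> 0"
    proof
      assume "k = 0"
      then have "c = a \<otimes> t" using a by simp
      then show False using a N.I_l_closed[OF gN(2)] by auto
    qed
    ultimately have "k = 1" by simp
    then have acp: "a \<otimes> t = c \<otimes> p" using a pc by simp
    obtain r g where r: "r \<in> carrier R - N" "g \<in> carrier R" "r \<otimes> x = g \<otimes> p"
      using uniformizer_divides_locally[OF N(1) p xN] by blast
    \<comment> \<open>Order one lets \<open>t\<close> replace \<open>p\<close>: locally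
      \<open>x\<close> is a multiple of \<open>p\<close>, hence of \<open>t\<close>, which lies in
      \<open>I\<close>.\<close>
    have "(c \<otimes> r) \<otimes> x = c \<otimes> (r \<otimes> x)" using ac r(1) x by (simp add: m_assoc)
    also have "\<dots> = g \<otimes> (c \<otimes> p)" unfolding r(3) using ac r(2) pc by (simp add: m_ac)
    also have "\<dots> = g \<otimes> a \<otimes> t" unfolding acp[symmetric] using ac r(2) tc by (simp add: m_assoc)
    also have "\<dots> \<in> I" using I.I_l_closed[OF gI(2)] ac r(2) by blast
    finally have "c \<otimes> r \<in> Q" unfolding Q_def using ac r by simp
    then show False using N(2) maximalideal_mult_notin[OF N(1) a(2) r(1)] by blast
  qed
  have "x \<in> radical R I" if "x \<in> I" for x
    using that I.a_subset nat_pow_eone[of x] unfolding radical_def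
    by (auto intro!: exI[of _ "1::nat"])
  then have "radical_ideal I R"
    using I rad unfolding radical_ideal_def radical_def by blast
  moreover have "fin_gen_ideal I R"
    unfolding fin_gen_ideal_def I_def using gens by blast
  ultimately show ?thesis
    using M(1) IM gI(1) y(2) unfolding critical_ideals_def max_ideals_def by blast
qed

theorem theorem4p5:
  fixes D :: "('a, 'm) ring_scheme"
  assumes "almost_dedekind_domain D"
  shows "(\<not> field D \<longrightarrow>
            critical_ideals D \<noteq> max_ideals D \<and> (\<exists>M\<in>max_ideals D. M \<notin> critical_ideals D))
         \<and> \<not> anti_SP_domain D"
proof -
  interpret domain D using assms by (simp add: almost_dedekind_domain_def)
  \<comment> \<open>One such ideal settles every claim, since it separates
    \<open>critical_ideals D\<close> from \<open>max_ideals D\<close>, whose equality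
    \<open>anti_SP_domain\<close> demands.\<close>
  have "\<exists>M\<in>max_ideals D. M \<notin> critical_ideals D"
    using assms exists_uniformizer
    by (intro exists_noncritical) (auto simp: almost_dedekind_domain_def max_ideals_def)
  then show ?thesis unfolding anti_SP_domain_def by blast
qed

end
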